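(* Let $m\ge 3$ and let $C_1,\ldots,C_m,\mathcal S$ be nonempty, closed and convex subsets of $\mathbb R^n$ which are pairwise disjoint. Assume that all weights $\rho_i$ and $\omega_i$, $i=1,\ldots,m$, are strictly positive, and that at least one of the sets $C_1,\ldots,C_m,\mathcal S$ is bounded, which guarantees the existence of an optimal solution $\mathbf u^*\in\Omega$ of the problem $\min_{\mathbf u\in\Omega}J(\mathbf u)$; let $J^*:=J(\mathbf u^* )$ be the optimal value. Let $\mathbf u^{(0)}\in\Omega$ and let $\{\mathbf u^{(k)}\}_{k\ge 0}$ be the sequence generated by the Projected Subgradient Algorithm $$\mathbf u^{(k+1)}=\operatorname{proj}_\Omega\bigl(\mathbf u^{(k)}-\alpha_k g^{(k)}\bigr),\qquad k\ge 0,$$ where $g^{(k)}\in\partial J(\mathbf u^{(k)})$ is the subgradient given by the explicit formulas in the context, and the step sizes satisfy $$\alpha_k>0,\qquad\sum_{k=0}^\infty\alpha_k=\infty,\qquad\sum_{k=0}^\infty\alpha_k^2<\infty.$$ Then the best-iterate values $J_{\mathrm{best}}^{(N)}:=\min_{0\le k<N}J(\mathbf u^{(k)})$ satisfy $\lim_{N\to\infty}J_{\mathrm{best}}^{(N)}=J^*$, and the sequence $\mathbf u^{(k)}$ converges to an optimal solution of the problem.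
   Context: The space $\mathbb R^n$ carries the Euclidean norm $\|\cdot\|$. The feasible set is $\Omega:=C_1\times\cdots\times C_m\times\mathcal S\subset\mathbb R^{n(m+1)}$, and for $\mathbf u=(a_1,\ldots,a_m,x)$ the objective is $$J(\mathbf u):=\sum_{i=1}^m\rho_i\|a_i-a_{i+1}\|+\sum_{i=1}^m\omega_i\|a_i-x\|,\qquad a_{m+1}:=a_1.$$ $\operatorname{proj}_\Omega$ is the Euclidean projection onto the closed convex set $\Omega$, and $\partial J$ is the convex subdifferential. Writing $\mathbf u^{(k)}=(a_1^{(k)},\ldots,a_m^{(k)},x^{(k)})$, the vector $g^{(k)}=(g_{a_1}^{(k)},\ldots,g_{a_m}^{(k)},g_x^{(k)})$ is defined as follows, with cyclic indices $a_0^{(k)}:=a_m^{(k)}$, $a_{m+1}^{(k)}:=a_1^{(k)}$, $\rho_0:=\rho_m$. For $i=1,\ldots,m$, $$g_{a_i}^{(k)}=\rho_{i-1}\frac{a_i^{(k)}-a_{i-1}^{(k)}}{\|a_i^{(k)}-a_{i-1}^{(k)}\|}+\rho_i\frac{a_i^{(k)}-a_{i+1}^{(k)}}{\|a_i^{(k)}-a_{i+1}^{(k)}\|}+\omega_i\frac{a_i^{(k)}-x^{(k)}}{\|a_i^{(k)}-x^{(k)}\|}$$ if all denominators are nonzero, and $g_{a_i}^{(k)}=\mathbf 0$ otherwise; and $$g_x^{(k)}=\sum_{i=1}^m\omega_i\,e_i^{(k)},\qquad e_i^{(k)}=\frac{x^{(k)}-a_i^{(k)}}{\|x^{(k)}-a_i^{(k)}\|}\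 \text{ if }x^{(k)}\ne a_i^{(k)},\quad e_i^{(k)}=\mathbf 0\ \text{ otherwise}.$$ *)

theory Defs
  imports "HOL-Analysis.Analysis"
begin

text \<open>
  The space of vectors \<open>u = (a\<^sub>1, \<dots>, a\<^sub>m, x)\<close> is the euclidean space
  \<open>(real^'n)^'m \<times> real^'n\<close>, whose library norm is the Euclidean norm on
  \<open>\<real>\<^bsup>n(m+1)\<^esup>\<close>. The finite type \<open>'m\<close> has no cyclic order, so the numbering of the
  \<open>m\<close> blocks is supplied by a map \<open>idx\<close> which is assumed, wherever it matters, to be a
  bijection from \<open>{1..m}\<close> onto \<open>'m\<close>.
\<close>

type_synonym ('n, 'm) blocks = "((real^'n)^'m) \<times> (real^'n)"

text \<open>Cyclic convention on \<open>{0..m+1}\<close>: index \<open>0\<close> means \<open>m\<close> and index \<open>m+1\<close> means \<open>1\<close>.\<close>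

definition cyc :: "nat \<Rightarrow> nat \<Rightarrow> nat" where
  "cyc m i = (if i = 0 then m else if i = m + 1 then 1 else i)"

definition blk :: "nat \<Rightarrow> (nat \<Rightarrow> 'm::finite) \<Rightarrow> ('n::finite, 'm) blocks \<Rightarrow> nat \<Rightarrow> real^'n" where
  "blk m idx u i = fst u $ idx (cyc m i)"

definition feasible ::
  "nat \<Rightarrow> (nat \<Rightarrow> 'm::finite) \<Rightarrow> (nat \<Rightarrow> (real^'n::finite) set) \<Rightarrow> (real^'n) set
     \<Rightarrow> ('n, 'm) blocks set" where
  "feasible m idx C S = {u. (\<forall>i\<in>{1..m}. blk m idx u i \<in> C i) \<and> snd u \<in> S}"

definition objective ::
  "nat \<Rightarrow> (nat \<Rightarrow> 'm::finite) \<Rightarrow> (nat \<Rightarrow> real) \<Rightarrow> (nat \<Rightarrow> real)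
     \<Rightarrow> ('n::finite, 'm) blocks \<Rightarrow> real" where
  "objective m idx \<rho> \<omega> u =
     (\<Sum>i=1..m. \<rho> i * norm (blk m idx u i - blk m idx u (i + 1))) +
     (\<Sum>i=1..m. \<omega> i * norm (blk m idx u i - snd u))"

definition subdifferential :: "('a::real_inner \<Rightarrow> real) \<Rightarrow> 'a \<Rightarrow> 'a set" where
  "subdifferential f u = {g. \<forall>v. f u + g \<bullet> (v - u) \<le> f v}"

definition subgrad_a ::
  "nat \<Rightarrow> (nat \<Rightarrow> 'm::finite) \<Rightarrow> (nat \<Rightarrow> real) \<Rightarrow> (nat \<Rightarrow> real)
     \<Rightarrow> ('n::finite, 'm) blocks \<Rightarrow> nat \<Rightarrow> real^'n" where
  "subgrad_a m idx \<rho> \<omega> u i =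
     (let a = blk m idx u; x = snd u in
      if norm (a i - a (i - 1)) \<noteq> 0 \<and> norm (a i - a (i + 1)) \<noteq> 0 \<and> norm (a i - x) \<noteq> 0
      then \<rho> (cyc m (i - 1)) *\<^sub>R ((a i - a (i - 1)) /\<^sub>R norm (a i - a (i - 1)))
         + \<rho> i *\<^sub>R ((a i - a (i + 1)) /\<^sub>R norm (a i - a (i + 1)))
         + \<omega> i *\<^sub>R ((a i - x) /\<^sub>R norm (a i - x))
      else 0)"

definition subgrad_x ::
  "nat \<Rightarrow> (nat \<Rightarrow> 'm::finite) \<Rightarrow> (nat \<Rightarrow> real) \<Rightarrow> ('n::finite, 'm) blocks \<Rightarrow> real^'n" where
  "subgrad_x m idx \<omega> u =
     (\<Sum>i=1..m. \<omega> i *\<^sub>R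
        (if snd u \<noteq> blk m idx u i
         then (snd u - blk m idx u i) /\<^sub>R norm (snd u - blk m idx u i) else 0))"

definition subgrad ::
  "nat \<Rightarrow> (nat \<Rightarrow> 'm::finite) \<Rightarrow> (nat \<Rightarrow> real) \<Rightarrow> (nat \<Rightarrow> real)
     \<Rightarrow> ('n::finite, 'm) blocks \<Rightarrow> ('n, 'm) blocks" where
  "subgrad m idx \<rho> \<omega> u =
     ((\<chi> j. subgrad_a m idx \<rho> \<omega> u (the_inv_into {1..m} idx j)), subgrad_x m idx \<omega> u)"

text \<open>The minimum over \<open>0 \<le> k < N\<close>; meaningful for \<open>N \<ge> 1\<close> only.\<close>

definition best_value :: "('a \<Rightarrow> real) \<Rightarrow> (nat \<Rightarrow> 'a) \<Rightarrow> nat \<Rightarrow> real" where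
  "best_value f u N = Min ((\<lambda>k. f (u k)) ` {..<N})"

end

theory Submission
  imports Defs
begin

text \<open>
  Two facts carry the proof. First, disjointness of the sets keeps every feasible point away from
  the kinks of the objective \<open>J\<close>: there all denominators are nonzero, so the vector
  \<open>subgrad\<close> is the sum of the gradients of the weighted norms, and a cyclic reindexing of the
  resulting sum shows that it is a subgradient of \<open>J\<close> (lemma \<open>subgrad_in_subdifferential\<close>).
  Because \<open>J\<close> is Lipschitz, all these subgradients have norm at most the Lipschitz constant \<open>L\<close>.

  Second, one step of the projected subgradient method satisfies, for every feasible \<open>y\<close>,
  \<open>\<parallel>u\<^sub>k\<^sub>+\<^sub>1 - y\<parallel>\<^sup>2 \<le> \<parallel>u\<^sub>k - y\<parallel>\<^sup>2 - 2 \<alpha>\<^sub>k (J u\<^sub>k - J y) + L\<^sup>2 \<alpha>\<^sub>k\<^sup>2\<close>,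
  because the projection is nonexpansive and fixes \<open>y\<close>. Take for \<open>y\<close> a minimiser. As the
  \<open>\<alpha>\<^sub>k\<^sup>2\<close> are summable, the distances \<open>\<parallel>u\<^sub>k - y\<parallel>\<close> converge. As the \<open>\<alpha>\<^sub>k\<close> are not,
  \<open>J u\<^sub>k\<close> comes arbitrarily close to the minimum infinitely often; this gives the limit of the
  best values and a cluster point of the iterates that is a minimiser. The distances of the
  iterates to that cluster point converge, and along a subsequence they tend to zero, so the
  whole sequence converges to it.

  A minimiser exists because the terms \<open>\<omega>\<^sub>i \<parallel>a\<^sub>i - x\<parallel>\<close> tie all blocks to \<open>x\<close>: on a sublevel set
  of \<open>J\<close>, boundedness of a single block bounds all the others.
\<close>

section \<open>The projected subgradient method\<close>

text \<open>Inserting the step \<open>v = x + g\<close> into the subgradient inequality gives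
  \<open>\<parallel>g\<parallel>\<^sup>2 \<le> L \<parallel>g\<parallel>\<close>.\<close>

lemma norm_subgradient_le_lipschitz:
  assumes "L-lipschitz_on UNIV f" and "g \<in> subdifferential f x"
  shows "norm g \<le> L"
proof -
  have "f x + g \<bullet> g \<le> f (x + g)"
    using assms(2) by (auto simp: subdifferential_def dest: spec[of _ "x + g"])
  moreover have "f (x + g) - f x \<le> L * norm g"
    using lipschitz_onD[OF assms(1), of "x + g" x] by (simp add: dist_norm)
  ultimately have "norm g * norm g \<le> L * norm g"
    by (simp add: dot_square_norm power2_eq_square)
  then show ?thesis
    using lipschitz_on_nonneg[OF assms(1)] by (cases "g = 0") auto
qed

text \<open>The projection fixes \<open>y\<close> and is nonexpansive, so the step before projecting may be estimated
  instead; expanding the square leaves the inner product that the subgradient inequality bounds.\<close>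

lemma projected_subgradient_step:
  fixes f :: "'a::euclidean_space \<Rightarrow> real"
  assumes "closed X" "convex X" "y \<in> X"
    and "g \<in> subdifferential f x" and "norm g \<le> L" and "a \<ge> 0"
  shows "(norm (closest_point X (x - a *\<^sub>R g) - y))\<^sup>2
           \<le> (norm (x - y))\<^sup>2 - 2 * a * (f x - f y) + L\<^sup>2 * a\<^sup>2"
proof -
  have "norm (closest_point X (x - a *\<^sub>R g) - y) \<le> norm (x - a *\<^sub>R g - y)"
    using closest_point_lipschitz[of X "x - a *\<^sub>R g" y] assms
    by (auto simp: closest_point_self dist_norm)
  then have "(norm (closest_point X (x - a *\<^sub>R g) - y))\<^sup>2 \<le> (norm (x - a *\<^sub>R g - y))\<^sup>2"
    by (simp add: power_mono)
  also have "\<dots> = (norm (x - y))\<^sup>2 - 2 * a * (g \<bullet> (x - y)) + a\<^sup>2 * (norm g)\<^sup>2"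
    by (simp only: power2_norm_eq_inner) (simp add: algebra_simps inner_commute power2_eq_square)
  also have "\<dots> \<le> (norm (x - y))\<^sup>2 - 2 * a * (f x - f y) + a\<^sup>2 * L\<^sup>2"
  proof -
    have "f x + g \<bullet> (y - x) \<le> f y"
      using assms(4) by (auto simp: subdifferential_def)
    then have "a * (f x - f y) \<le> a * (g \<bullet> (x - y))"
      using \<open>a \<ge> 0\<close> by (intro mult_left_mono) (auto simp: inner_diff_right)
    moreover have "a\<^sup>2 * (norm g)\<^sup>2 \<le> a\<^sup>2 * L\<^sup>2"
      using assms(5) by (intro mult_left_mono power_mono) auto
    ultimately show ?thesis by simp
  qed
  finally show ?thesis by (simp add: mult.commute)
qed

text \<open>Subtracting the partial sums of the errors \<open>e\<close> makes the sequence decreasing.\<close>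

lemma convergent_almost_decreasing:
  fixes d e :: "nat \<Rightarrow> real"
  assumes step: "\<And>k. d (Suc k) \<le> d k + e k" and "\<And>k. d k \<ge> 0" and "\<And>k. e k \<ge> 0"
    and "summable e"
  shows "convergent d"
proof -
  let ?E = "\<lambda>k. \<Sum>j<k. e j"
  have "decseq (\<lambda>k. d k - ?E k)"
    using step by (intro decseq_SucI) (simp add: algebra_simps)
  moreover have "- suminf e \<le> d k - ?E k" for k
    using assms(2)[of k] sum_le_suminf[OF \<open>summable e\<close>, of "{..<k}"] assms(3) by simp
  ultimately obtain l where "(\<lambda>k. d k - ?E k) \<longlonglongrightarrow> l"
    using decseq_convergent by blast
  from tendsto_add[OF this summable_LIMSEQ[OF \<open>summable e\<close>]] show ?thesis
    by (auto simp: convergent_def)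
qed

text \<open>If the gap \<open>c\<close> stayed above \<open>\<epsilon>\<close> from some index on, each step would lower \<open>d\<close> by
  \<open>\<epsilon> \<alpha>\<^sub>k\<close> up to a summable error; the divergence of the step sizes would drive \<open>d\<close>
  below zero.\<close>

lemma frequently_small_gap:
  fixes d e c \<alpha> :: "nat \<Rightarrow> real"
  assumes step: "\<And>k. d (Suc k) \<le> d k - \<alpha> k * c k + e k" and "\<And>k. d k \<ge> 0" and "\<And>k. e k \<ge> 0"
    and "summable e" and "\<And>k. \<alpha> k > 0"
    and div: "filterlim (\<lambda>N. \<Sum>k<N. \<alpha> k) at_top sequentially" and "\<epsilon> > 0"
  shows "\<exists>k\<ge>K. c k < \<epsilon>"
proof (rule ccontr)
  assume "\<not> ?thesis"
  then have big: "c k \<ge> \<epsilon>" if "k \<ge> K" for k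
    using that by force
  have dec: "d N + \<epsilon> * (\<Sum>k<N. \<alpha> k) - (\<Sum>k<N. e k) \<le> d K + \<epsilon> * (\<Sum>k<K. \<alpha> k) - (\<Sum>k<K. e k)"
    if "N \<ge> K" for N
    using that
  proof (induction N rule: dec_induct)
    case (step N)
    have "\<epsilon> * \<alpha> N \<le> \<alpha> N * c N"
      using big[of N] step(1) assms(5)[of N] by (simp add: mult.commute)
    then show ?case
      using step(3) assms(1)[of N] by (simp add: algebra_simps)
  qed simp
  \<comment> \<open>\<open>B\<close> comes from \<open>dec\<close> by dropping \<open>d N \<ge> 0\<close> and replacing the partial sum of the errors by the
    whole series, so it does not depend on \<open>N\<close>.\<close>
  define B where "B = (d K + \<epsilon> * (\<Sum>k<K. \<alpha> k) - (\<Sum>k<K. e k) + suminf e) / \<epsilon>"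
  have "(\<Sum>k<N. \<alpha> k) \<le> B" if "N \<ge> K" for N
  proof -
    have "\<epsilon> * (\<Sum>k<N. \<alpha> k) \<le> d K + \<epsilon> * (\<Sum>k<K. \<alpha> k) - (\<Sum>k<K. e k) + suminf e"
      using dec[OF that] assms(2)[of N] sum_le_suminf[OF \<open>summable e\<close>, of "{..<N}"] assms(3)
      by simp
    then show ?thesis
      using \<open>\<epsilon> > 0\<close> by (simp add: B_def field_simps)
  qed
  moreover obtain N where "N \<ge> K" "(\<Sum>k<N. \<alpha> k) > B"
    using div unfolding filterlim_at_top_dense eventually_sequentially
    by (metis nle_le)
  ultimately show False by force
qed

text \<open>The distances of the iterates to any minimiser converge, not only those to the given
  \<open>y\<close>. This is applied once to \<open>y\<close>, to see that the iterates are bounded, and a second time to the cluster point \<open>z\<close>, where the limit of the distances has to be zero.\<close>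

theorem projected_subgradient_convergence:
  fixes f :: "'a::euclidean_space \<Rightarrow> real" and u g :: "nat \<Rightarrow> 'a"
  assumes X: "closed X" "convex X"
    and L: "L-lipschitz_on UNIV f"
    and u: "\<And>k. u k \<in> X"
    and step: "\<And>k. u (Suc k) = closest_point X (u k - \<alpha> k *\<^sub>R g k)"
    and g: "\<And>k. g k \<in> subdifferential f (u k)"
    and pos: "\<And>k. \<alpha> k > 0"
    and div: "filterlim (\<lambda>N. \<Sum>k<N. \<alpha> k) at_top sequentially"
    and sq: "summable (\<lambda>k. (\<alpha> k)\<^sup>2)"
    and ystar: "is_arg_min f (\<lambda>x. x \<in> X) y"
  shows "best_value f u \<longlonglongrightarrow> f y"
    and "\<exists>z. is_arg_min f (\<lambda>x. x \<in> X) z \<and> u \<longlonglongrightarrow> z"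
proof -
  have y: "y \<in> X" and min: "\<And>x. x \<in> X \<Longrightarrow> f y \<le> f x"
    using ystar by (auto simp: is_arg_min_linorder)
  let ?e = "\<lambda>k. L\<^sup>2 * (\<alpha> k)\<^sup>2"
  have e: "summable ?e" "\<And>k. ?e k \<ge> 0"
    using sq by (auto intro: summable_mult)
  have ineq: "(norm (u (Suc k) - z))\<^sup>2 \<le> (norm (u k - z))\<^sup>2 - 2 * \<alpha> k * (f (u k) - f z) + ?e k"
    if "z \<in> X" for z k
    using projected_subgradient_step[OF X that g norm_subgradient_le_lipschitz[OF L g], of "\<alpha> k"]
      pos[of k] by (simp add: step)
  have conv: "convergent (\<lambda>k. (norm (u k - z))\<^sup>2)" if "z \<in> X" "f z = f y" for z
  proof (rule convergent_almost_decreasing[OF _ _ e(2) e(1)])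
    fix k
    have "\<alpha> k * (f (u k) - f z) \<ge> 0"
      using min[OF u] pos[of k] that by simp
    then show "(norm (u (Suc k) - z))\<^sup>2 \<le> (norm (u k - z))\<^sup>2 + ?e k"
      using ineq[OF that(1), of k] by simp
  qed simp
  have near: "\<exists>k\<ge>K. f (u k) < f y + \<epsilon>" if "\<epsilon> > 0" for K \<epsilon>
  proof -
    have "\<exists>k\<ge>K. 2 * (f (u k) - f y) < 2 * \<epsilon>"
    proof (rule frequently_small_gap[where d = "\<lambda>k. (norm (u k - y))\<^sup>2" and e = ?e])
      show "(norm (u (Suc k) - y))\<^sup>2 \<le> (norm (u k - y))\<^sup>2 - \<alpha> k * (2 * (f (u k) - f y)) + ?e k" for k
        using ineq[OF y, of k] by (simp add: mult_ac)
    qed (use e pos div that in simp_all)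
    then obtain k where "k \<ge> K" "2 * (f (u k) - f y) < 2 * \<epsilon>"
      by blast
    then show ?thesis by (intro exI[of _ k]) simp
  qed
  show "best_value f u \<longlonglongrightarrow> f y"
  proof (rule LIMSEQ_I)
    fix \<epsilon> :: real assume "\<epsilon> > 0"
    then obtain K where K: "f (u K) < f y + \<epsilon>"
      using near by blast
    have "norm (best_value f u N - f y) < \<epsilon>" if "N \<ge> Suc K" for N
    proof -
      let ?V = "(\<lambda>k. f (u k)) ` {..<N}"
      have V: "f (u K) \<in> ?V"
        using that by auto
      then have "?V \<noteq> {}"
        by blast
      with V have "Min ?V \<le> f (u K)" "f y \<le> Min ?V"
        using min[OF u] by auto
      then show ?thesis
        using K by (simp add: best_value_def)
    qed
    then show "\<exists>N0. \<forall>N\<ge>N0. norm (best_value f u N - f y) < \<epsilon>" by blast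
  qed
  show "\<exists>z. is_arg_min f (\<lambda>x. x \<in> X) z \<and> u \<longlonglongrightarrow> z"
  proof -
    have "\<forall>n. \<exists>k\<ge>n. f (u k) < f y + inverse (real (Suc n))"
      using near by simp
    \<comment> \<open>The selection \<open>\<kappa>\<close> need not be monotone; \<open>\<kappa> n \<ge> n\<close> suffices for \<open>\<kappa> (r n)\<close> to tend to infinity.\<close>
    then obtain \<kappa> where \<kappa>: "\<And>n. \<kappa> n \<ge> n" "\<And>n. f (u (\<kappa> n)) < f y + inverse (real (Suc n))"
      by metis
    have "Bseq (\<lambda>k. (norm (u k - y))\<^sup>2)"
      using conv[OF y] by (simp add: convergent_imp_Bseq)
    then obtain B where "\<And>k. (norm (u k - y))\<^sup>2 \<le> B"
      by (auto simp: Bseq_def)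
    then have B: "u k \<in> cball y (sqrt B)" for k
      by (simp add: dist_norm norm_minus_commute real_le_rsqrt)
    obtain z r where r: "strict_mono r" and z: "(\<lambda>n. u (\<kappa> (r n))) \<longlonglongrightarrow> z"
      using compact_cball[of y "sqrt B"] B unfolding compact_def
      by (auto simp: o_def dest: spec[of _ "\<lambda>n. u (\<kappa> n)"])
    have "z \<in> X"
      by (rule closed_sequentially[OF X(1) _ z]) (rule u)
    have sub: "filterlim (\<lambda>n. \<kappa> (r n)) at_top sequentially"
      by (rule filterlim_at_top_mono[OF filterlim_subseq[OF r]]) (simp add: \<kappa>(1))
    have "(\<lambda>n. f (u (\<kappa> (r n)))) \<longlonglongrightarrow> f z"
      using lipschitz_on_continuous_on[OF L] z by (auto intro: continuous_on_tendsto_compose)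
    moreover have "(\<lambda>n. f y + inverse (real (Suc (r n)))) \<longlonglongrightarrow> f y + 0"
      using LIMSEQ_subseq_LIMSEQ[OF LIMSEQ_inverse_real_of_nat r]
      by (intro tendsto_intros) (simp add: o_def)
    ultimately have "f z \<le> f y"
      using \<kappa>(2) by (intro LIMSEQ_le[of _ "f z" _ "f y + 0", simplified]) (auto intro: less_imp_le)
    then have fz: "f z = f y"
      using min[OF \<open>z \<in> X\<close>] by simp
    obtain l where l: "(\<lambda>k. (norm (u k - z))\<^sup>2) \<longlonglongrightarrow> l"
      using conv[OF \<open>z \<in> X\<close> fz] by (auto simp: convergent_def)
    have "(\<lambda>n. (norm (u (\<kappa> (r n)) - z))\<^sup>2) \<longlonglongrightarrow> (norm (z - z))\<^sup>2"
      by (intro tendsto_intros z)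
    moreover have "(\<lambda>n. (norm (u (\<kappa> (r n)) - z))\<^sup>2) \<longlonglongrightarrow> l"
      using filterlim_compose[OF l sub] .
    ultimately have "l = 0"
      by (metis LIMSEQ_unique diff_self norm_zero zero_power2)
    then have "(\<lambda>k. norm (u k - z)) \<longlonglongrightarrow> 0"
      using tendsto_real_sqrt[OF l] by simp
    then have "u \<longlonglongrightarrow> z"
      by (simp add: LIM_zero_iff tendsto_norm_zero_iff)
    moreover have "is_arg_min f (\<lambda>x. x \<in> X) z"
      using \<open>z \<in> X\<close> fz min by (simp add: is_arg_min_linorder)
    ultimately show ?thesis by blast
  qed
qed

section \<open>The explicit vector is a subgradient\<close>

lemma norm_subgradient_sgn:
  fixes p q :: "'a::real_inner"
  shows "norm p + sgn p \<bullet> (q - p) \<le> norm q"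
proof (cases "p = 0")
  case False
  have "sgn p \<bullet> p = norm p"
    using False by (simp add: sgn_div_norm dot_square_norm power2_eq_square)
  moreover have "sgn p \<bullet> q \<le> norm q"
    using norm_cauchy_schwarz[of "sgn p" q] False by (simp add: norm_sgn)
  ultimately show ?thesis
    by (simp add: inner_diff_right)
qed simp

lemma sum_cyclic_shift:
  fixes F :: "nat \<Rightarrow> 'a::ab_group_add"
  assumes "F (m + 1) = F 1"
  shows "(\<Sum>i=1..m. F (i + 1)) = (\<Sum>i=1..m. F i)"
proof -
  have "(\<Sum>i=1..n. F (i + 1)) + F 1 = (\<Sum>i=1..n. F i) + F (n + 1)" for n
    by (induction n) (auto simp: algebra_simps)
  from this[of m] show ?thesis
    using assms by simp
qed

lemma cyc_id [simp]: "i \<in> {1..m} \<Longrightarrow> cyc m i = i"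
  by (simp add: cyc_def)

lemma blk_0 [simp]: "m \<ge> 1 \<Longrightarrow> blk m idx u 0 = blk m idx u m"
  by (simp add: blk_def cyc_def)

lemma blk_Suc_m [simp]: "m \<ge> 1 \<Longrightarrow> blk m idx u (Suc m) = blk m idx u 1"
  by (simp add: blk_def cyc_def)

lemma linear_blk: "linear (\<lambda>u. blk m idx u i)"
  by (rule linearI) (simp_all add: blk_def)

lemma blk_diff: "blk m idx (u - v) i = blk m idx u i - blk m idx v i"
  by (simp add: blk_def)

lemma norm_blk_le: "norm (blk m idx u i) \<le> norm u"
  unfolding blk_def using order_trans[OF Finite_Cartesian_Product.norm_nth_le norm_fst_le[of "fst u" "snd u"]] by simp

lemma norm_snd_le_norm: "norm (snd u) \<le> norm u"
  using norm_snd_le[of "snd u" "fst u"] by simp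

lemma sum_over_blocks:
  fixes F :: "'m::finite \<Rightarrow> 'a::comm_monoid_add"
  assumes "bij_betw idx {1..m} (UNIV :: 'm set)"
  shows "(\<Sum>j\<in>UNIV. F j) = (\<Sum>i=1..m. F (idx i))"
  using sum.reindex_bij_betw[OF assms, of F] by simp

lemma inner_subgrad:
  assumes bij: "bij_betw idx {1..m} (UNIV :: 'm::finite set)"
  shows "subgrad m idx \<rho> \<omega> u \<bullet> w =
    (\<Sum>i=1..m. subgrad_a m idx \<rho> \<omega> u i \<bullet> blk m idx w i) + subgrad_x m idx \<omega> u \<bullet> snd w"
proof -
  have "the_inv_into {1..m} idx (idx i) = i" if "i \<in> {1..m}" for i
    using bij that by (simp add: bij_betw_def the_inv_into_f_f)
  then show ?thesis
    by (simp add: subgrad_def inner_prod_def inner_vec_def sum_over_blocks[OF bij] blk_def)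
qed

text \<open>The subgradient inequalities of the single norms add up to a bound in which the edge
  between the blocks \<open>i\<close> and \<open>i + 1\<close> contributes to both of these blocks. Shifting the
  cyclic index in the contributions to the second block collects, for each block, exactly
  the two edge terms of \<open>subgrad_a\<close>.\<close>

lemma subgrad_in_subdifferential:
  fixes u :: "('n::finite, 'm::finite) blocks"
  assumes m: "m \<ge> 1" and bij: "bij_betw idx {1..m} (UNIV :: 'm set)"
    and wt: "\<And>i. i \<in> {1..m} \<Longrightarrow> \<rho> i \<ge> 0 \<and> \<omega> i \<ge> 0"
    and adj: "\<And>i. i \<in> {1..m} \<Longrightarrow> blk m idx u i \<noteq> blk m idx u (i + 1)"
    and cen: "\<And>i. i \<in> {1..m} \<Longrightarrow> blk m idx u i \<noteq> snd u"
  shows "subgrad m idx \<rho> \<omega> u \<in> subdifferential (objective m idx \<rho> \<omega>) u"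
  unfolding subdifferential_def
proof (intro CollectI allI)
  fix v :: "('n, 'm) blocks"
  let ?a = "blk m idx u" and ?b = "blk m idx v" and ?x = "snd u" and ?y = "snd v"
  define d where "d = (\<lambda>i. ?b i - ?a i)"
  define dx where "dx = ?y - ?x"
  have pred: "?a i \<noteq> ?a (i - 1)" if "i \<in> {1..m}" for i
  proof (cases "i = 1")
    case True
    then show ?thesis using adj[of m] m by auto
  next
    case False
    then have "i - 1 \<in> {1..m}" "i - 1 + 1 = i"
      using that by auto
    then show ?thesis using adj[of "i - 1"] by metis
  qed
  have ga: "subgrad_a m idx \<rho> \<omega> u i =
      \<rho> (cyc m (i - 1)) *\<^sub>R sgn (?a i - ?a (i - 1)) + \<rho> i *\<^sub>R sgn (?a i - ?a (i + 1))
      + \<omega> i *\<^sub>R sgn (?a i - ?x)" if "i \<in> {1..m}" for i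
    using pred[OF that] adj[OF that] cen[OF that]
    by (simp add: subgrad_a_def sgn_div_norm Let_def)
  have gx: "subgrad_x m idx \<omega> u = (\<Sum>i=1..m. \<omega> i *\<^sub>R sgn (?x - ?a i))"
    unfolding subgrad_x_def by (intro sum.cong) (auto simp: sgn_div_norm)
  have shift: "(\<Sum>i=1..m. \<rho> i * (sgn (?a i - ?a (i + 1)) \<bullet> d (i + 1)))
      = (\<Sum>i=1..m. - \<rho> (cyc m (i - 1)) * (sgn (?a i - ?a (i - 1)) \<bullet> d i))"
  proof -
    let ?F = "\<lambda>j. \<rho> (cyc m (j - 1)) * (sgn (?a (j - 1) - ?a j) \<bullet> d j)"
    have "?F (m + 1) = ?F 1"
      using m by (simp add: d_def) (simp add: cyc_def)
    from sum_cyclic_shift[of ?F, OF this]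
    have "(\<Sum>i=1..m. \<rho> i * (sgn (?a i - ?a (i + 1)) \<bullet> d (i + 1))) = (\<Sum>i=1..m. ?F i)"
      by simp
    also have "\<dots> = (\<Sum>i=1..m. - \<rho> (cyc m (i - 1)) * (sgn (?a i - ?a (i - 1)) \<bullet> d i))"
    proof (rule sum.cong[OF refl])
      fix i
      have "sgn (?a (i - 1) - ?a i) = - sgn (?a i - ?a (i - 1))"
        by (metis minus_diff_eq sgn_minus)
      then show "?F i = - \<rho> (cyc m (i - 1)) * (sgn (?a i - ?a (i - 1)) \<bullet> d i)"
        by simp
    qed
    finally show ?thesis .
  qed
  have sgnx: "sgn (?x - ?a i) = - sgn (?a i - ?x)" for i
    by (metis minus_diff_eq sgn_minus)
  have "subgrad m idx \<rho> \<omega> u \<bullet> (v - u)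
      = (\<Sum>i=1..m. subgrad_a m idx \<rho> \<omega> u i \<bullet> d i) + subgrad_x m idx \<omega> u \<bullet> dx"
    by (simp add: inner_subgrad[OF bij] blk_diff d_def dx_def)
  also have "(\<Sum>i=1..m. subgrad_a m idx \<rho> \<omega> u i \<bullet> d i)
      = (\<Sum>i=1..m. \<rho> (cyc m (i - 1)) * (sgn (?a i - ?a (i - 1)) \<bullet> d i)
          + \<rho> i * (sgn (?a i - ?a (i + 1)) \<bullet> d i) + \<omega> i * (sgn (?a i - ?x) \<bullet> d i))"
    by (intro sum.cong refl) (simp add: ga inner_add_left)
  also have "subgrad_x m idx \<omega> u \<bullet> dx = - (\<Sum>i=1..m. \<omega> i * (sgn (?a i - ?x) \<bullet> dx))"
    by (simp add: gx inner_sum_left sgnx sum_negf)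
  finally have g: "subgrad m idx \<rho> \<omega> u \<bullet> (v - u)
      = (\<Sum>i=1..m. \<rho> i * (sgn (?a i - ?a (i + 1)) \<bullet> (d i - d (i + 1))))
        + (\<Sum>i=1..m. \<omega> i * (sgn (?a i - ?x) \<bullet> (d i - dx)))"
    using shift by (simp add: inner_diff_right right_diff_distrib sum.distrib sum_subtractf sum_negf)
  have "\<rho> i * norm (?a i - ?a (i + 1)) + \<rho> i * (sgn (?a i - ?a (i + 1)) \<bullet> (d i - d (i + 1)))
      \<le> \<rho> i * norm (?b i - ?b (i + 1))" if "i \<in> {1..m}" for i
    using mult_left_mono[OF norm_subgradient_sgn[of "?a i - ?a (i + 1)" "?b i - ?b (i + 1)"], of "\<rho> i"]
      wt[OF that] by (simp add: d_def algebra_simps)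
  moreover have "\<omega> i * norm (?a i - ?x) + \<omega> i * (sgn (?a i - ?x) \<bullet> (d i - dx))
      \<le> \<omega> i * norm (?b i - ?y)" if "i \<in> {1..m}" for i
    using mult_left_mono[OF norm_subgradient_sgn[of "?a i - ?x" "?b i - ?y"], of "\<omega> i"]
      wt[OF that] by (simp add: d_def dx_def algebra_simps)
  ultimately have
    "(\<Sum>i=1..m. \<rho> i * norm (?a i - ?a (i + 1)) + \<rho> i * (sgn (?a i - ?a (i + 1)) \<bullet> (d i - d (i + 1))))
      + (\<Sum>i=1..m. \<omega> i * norm (?a i - ?x) + \<omega> i * (sgn (?a i - ?x) \<bullet> (d i - dx)))
      \<le> (\<Sum>i=1..m. \<rho> i * norm (?b i - ?b (i + 1))) + (\<Sum>i=1..m. \<omega> i * norm (?b i - ?y))"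
    by (intro add_mono sum_mono)
  then show "objective m idx \<rho> \<omega> u + subgrad m idx \<rho> \<omega> u \<bullet> (v - u) \<le> objective m idx \<rho> \<omega> v"
    by (simp add: g objective_def sum.distrib)
qed

section \<open>The feasible set and the objective\<close>

lemma feasible_eq_vimages:
  "feasible m idx C S = (\<Inter>i\<in>{1..m}. (\<lambda>u. blk m idx u i) -` C i) \<inter> snd -` S"
  by (auto simp: feasible_def)

lemma closed_feasible:
  assumes "\<And>i. i \<in> {1..m} \<Longrightarrow> closed (C i)" and "closed S"
  shows "closed (feasible m idx C S)"
  unfolding feasible_eq_vimages
  using assms by (intro closed_Int closed_INT ballI closed_vimage)
    (auto simp: linear_blk linear_continuous_on linear_conv_bounded_linear[symmetric]
          intro!: continuous_intros)

lemma convex_feasible: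
  assumes "\<And>i. i \<in> {1..m} \<Longrightarrow> convex (C i)" and "convex S"
  shows "convex (feasible m idx C S)"
  unfolding feasible_eq_vimages
  using assms by (intro convex_Int convex_INT convex_linear_vimage linear_blk linear_snd) auto

text \<open>The condition \<open>m \<ge> 2\<close> makes the cyclic successor of a block a different block, whose set is
  disjoint from its own.\<close>

lemma feasible_blocks_distinct:
  assumes "m \<ge> 2" "disjoint_family_on C {1..m}"
    and "\<And>i. i \<in> {1..m} \<Longrightarrow> C i \<inter> S = {}" and "u \<in> feasible m idx C S" and i: "i \<in> {1..m}"
  shows "blk m idx u i \<noteq> blk m idx u (i + 1)" and "blk m idx u i \<noteq> snd u"
proof -
  have mem: "blk m idx u j \<in> C j" if "j \<in> {1..m}" for j
    using assms(4) that by (auto simp: feasible_def)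
  show "blk m idx u i \<noteq> snd u"
    using mem[OF i] assms(3)[OF i] assms(4) by (auto simp: feasible_def)
  define j where "j = cyc m (i + 1)"
  have j: "j \<in> {1..m}" "j \<noteq> i"
    using i assms(1) by (auto simp: j_def cyc_def)
  have "blk m idx u (i + 1) = blk m idx u j"
    using j(1) unfolding blk_def by (simp add: j_def)
  then show "blk m idx u i \<noteq> blk m idx u (i + 1)"
    using mem[OF i] mem[OF j(1)] disjoint_family_onD[OF assms(2) i j(1)] j(2) by auto
qed

lemma lipschitz_objective:
  fixes idx :: "nat \<Rightarrow> 'm::finite"
  assumes wt: "\<And>i. i \<in> {1..m} \<Longrightarrow> \<rho> i \<ge> 0 \<and> \<omega> i \<ge> 0"
  shows "((\<Sum>i=1..m. 2 * \<rho> i) + (\<Sum>i=1..m. 2 * \<omega> i))-lipschitz_on UNIV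
    (objective m idx \<rho> \<omega> :: ('n::finite, 'm) blocks \<Rightarrow> real)"
proof (rule lipschitz_onI)
  fix u v :: "('n, 'm) blocks"
  have diff: "\<bar>norm (p - q) - norm (p' - q')\<bar> \<le> norm (p - p') + norm (q - q')"
    for p q p' q' :: "real^'n"
    by norm
  have edge: "\<bar>\<rho> i * norm (blk m idx u i - blk m idx u (i + 1))
      - \<rho> i * norm (blk m idx v i - blk m idx v (i + 1))\<bar> \<le> 2 * \<rho> i * norm (u - v)"
    if "i \<in> {1..m}" for i
  proof -
    have "\<bar>norm (blk m idx u i - blk m idx u (i + 1)) - norm (blk m idx v i - blk m idx v (i + 1))\<bar>
        \<le> 2 * norm (u - v)"
      using diff[of "blk m idx u i" "blk m idx u (i + 1)" "blk m idx v i" "blk m idx v (i + 1)"]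
        norm_blk_le[of m idx "u - v" i] norm_blk_le[of m idx "u - v" "i + 1"]
      by (simp add: blk_diff)
    from mult_left_mono[OF this, of "\<rho> i"] show ?thesis
      using wt[OF that] by (simp add: abs_mult right_diff_distrib[symmetric] mult_ac)
  qed
  have spoke: "\<bar>\<omega> i * norm (blk m idx u i - snd u) - \<omega> i * norm (blk m idx v i - snd v)\<bar>
      \<le> 2 * \<omega> i * norm (u - v)" if "i \<in> {1..m}" for i
  proof -
    have "\<bar>norm (blk m idx u i - snd u) - norm (blk m idx v i - snd v)\<bar> \<le> 2 * norm (u - v)"
      using diff[of "blk m idx u i" "snd u" "blk m idx v i" "snd v"]
        norm_blk_le[of m idx "u - v" i] norm_snd_le_norm[of "u - v"]
      by (simp add: blk_diff)
    from mult_left_mono[OF this, of "\<omega> i"] show ?thesis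
      using wt[OF that] by (simp add: abs_mult right_diff_distrib[symmetric] mult_ac)
  qed
  have "\<bar>objective m idx \<rho> \<omega> u - objective m idx \<rho> \<omega> v\<bar>
      \<le> \<bar>\<Sum>i=1..m. \<rho> i * norm (blk m idx u i - blk m idx u (i + 1))
            - \<rho> i * norm (blk m idx v i - blk m idx v (i + 1))\<bar>
        + \<bar>\<Sum>i=1..m. \<omega> i * norm (blk m idx u i - snd u) - \<omega> i * norm (blk m idx v i - snd v)\<bar>"
    unfolding objective_def sum_subtractf by linarith
  also have "\<dots> \<le> (\<Sum>i=1..m. 2 * \<rho> i * norm (u - v)) + (\<Sum>i=1..m. 2 * \<omega> i * norm (u - v))"
    by (intro add_mono order_trans[OF sum_abs] sum_mono edge spoke)
  finally show "dist (objective m idx \<rho> \<omega> u) (objective m idx \<rho> \<omega> v)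
      \<le> ((\<Sum>i=1..m. 2 * \<rho> i) + (\<Sum>i=1..m. 2 * \<omega> i)) * dist u v"
    by (simp add: dist_norm sum_distrib_right distrib_right)
qed (use wt in \<open>auto intro!: add_nonneg_nonneg sum_nonneg\<close>)

lemma norm_le_sum_blk:
  fixes u :: "('n::finite, 'm::finite) blocks"
  assumes bij: "bij_betw idx {1..m} (UNIV :: 'm set)"
  shows "norm u \<le> (\<Sum>i=1..m. norm (blk m idx u i)) + norm (snd u)"
proof -
  have "norm (fst u) \<le> (\<Sum>j\<in>UNIV. norm (fst u $ j))"
    unfolding norm_vec_def by (rule L2_set_le_sum) simp
  also have "\<dots> = (\<Sum>i=1..m. norm (blk m idx u i))"
    by (simp add: sum_over_blocks[OF bij] blk_def)
  finally show ?thesis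
    using norm_Pair_le[of "fst u" "snd u"] by simp
qed

lemma spoke_le_objective:
  assumes wt: "\<And>i. i \<in> {1..m} \<Longrightarrow> \<rho> i > 0 \<and> \<omega> i > 0" and i: "i \<in> {1..m}"
  shows "norm (blk m idx u i - snd u) \<le> objective m idx \<rho> \<omega> u / \<omega> i"
proof -
  have "\<omega> i * norm (blk m idx u i - snd u) \<le> (\<Sum>i=1..m. \<omega> i * norm (blk m idx u i - snd u))"
    using i wt by (intro member_le_sum) (auto simp: less_imp_le)
  also have "\<dots> \<le> objective m idx \<rho> \<omega> u"
    unfolding objective_def using wt by (auto intro!: sum_nonneg simp: less_imp_le)
  finally show ?thesis
    using wt[OF i] by (simp add: field_simps)
qed

text \<open>If some \<open>C\<^sub>i\<close> is bounded, the bound on \<open>\<parallel>a\<^sub>i - x\<parallel>\<close> carries over to \<open>x\<close>; once \<open>x\<close> is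
  bounded, in this way or because \<open>S\<close> is, the bounds on all \<open>\<parallel>a\<^sub>j - x\<parallel>\<close> control every block.\<close>

lemma bounded_sublevel_objective:
  assumes bij: "bij_betw idx {1..m} (UNIV :: 'm::finite set)"
    and wt: "\<And>i. i \<in> {1..m} \<Longrightarrow> \<rho> i > 0 \<and> \<omega> i > 0"
    and bd: "(\<exists>i\<in>{1..m}. bounded (C i)) \<or> bounded S"
  shows "bounded {u \<in> feasible m idx C S. objective m idx \<rho> \<omega> u \<le> c}"
proof -
  let ?A = "{u \<in> feasible m idx C S. objective m idx \<rho> \<omega> u \<le> c}"
  have spoke: "norm (blk m idx u i - snd u) \<le> c / \<omega> i" if "u \<in> ?A" "i \<in> {1..m}" for u i
  proof (rule order_trans[OF spoke_le_objective[OF wt that(2)]])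
    show "objective m idx \<rho> \<omega> u / \<omega> i \<le> c / \<omega> i"
      using that wt[OF that(2)] by (intro divide_right_mono) auto
  qed
  have "\<exists>R. \<forall>u\<in>?A. norm (snd u) \<le> R"
    using bd
  proof
    assume "bounded S"
    then show ?thesis
      by (auto simp: bounded_iff feasible_def)
  next
    assume "\<exists>i\<in>{1..m}. bounded (C i)"
    then obtain i B where i: "i \<in> {1..m}" and B: "\<forall>p\<in>C i. norm p \<le> B"
      unfolding bounded_iff by blast
    have "norm (snd u) \<le> B + c / \<omega> i" if "u \<in> ?A" for u
    proof -
      have "norm (blk m idx u i) \<le> B"
        using that i B by (auto simp: feasible_def)
      then show ?thesis
        using spoke[OF that i] norm_triangle_sub[of "snd u" "blk m idx u i"]
        by (simp add: norm_minus_commute)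
    qed
    then show ?thesis by blast
  qed
  then obtain R where R: "\<And>u. u \<in> ?A \<Longrightarrow> norm (snd u) \<le> R"
    by blast
  have "norm u \<le> (\<Sum>i=1..m. R + c / \<omega> i) + R" if "u \<in> ?A" for u
  proof -
    have "norm (blk m idx u i) \<le> R + c / \<omega> i" if "i \<in> {1..m}" for i
      using spoke[OF \<open>u \<in> ?A\<close> that] R[OF \<open>u \<in> ?A\<close>] norm_triangle_sub[of "blk m idx u i" "snd u"]
      by simp
    then have "(\<Sum>i=1..m. norm (blk m idx u i)) \<le> (\<Sum>i=1..m. R + c / \<omega> i)"
      by (rule sum_mono)
    then show ?thesis
      using norm_le_sum_blk[OF bij, of u] R[OF that] by linarith
  qed
  then show ?thesis
    unfolding bounded_iff by blast
qed

text \<open>Points of \<open>X\<close> outside the sublevel set of \<open>x\<close> have larger values than \<open>x\<close>, so it is enough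
  to minimise over that set, which is compact.\<close>

lemma exists_arg_min_of_bounded_sublevels:
  fixes f :: "'a::heine_borel \<Rightarrow> real"
  assumes "closed X" and cont: "continuous_on UNIV f" and x: "x \<in> X"
    and bd: "bounded {v \<in> X. f v \<le> f x}"
  shows "\<exists>y. is_arg_min f (\<lambda>v. v \<in> X) y"
proof -
  let ?A = "{v \<in> X. f v \<le> f x}"
  have "?A = X \<inter> {v. f v \<le> f x}" by auto
  moreover have "closed {v. f v \<le> f x}"
    by (intro closed_Collect_le cont continuous_on_const)
  ultimately have "compact ?A"
    using bd \<open>closed X\<close> by (metis closed_Int compact_eq_bounded_closed)
  moreover have "?A \<noteq> {}"
    using x by auto
  ultimately obtain y where y: "y \<in> ?A" "\<forall>v\<in>?A. f y \<le> f v"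
    using continuous_attains_inf[OF _ _ continuous_on_subset[OF cont subset_UNIV]] by meson
  have "f y \<le> f v" if "v \<in> X" for v
    using y that by (cases "f v \<le> f x") auto
  then show ?thesis
    using y(1) by (auto simp: is_arg_min_linorder)
qed

section \<open>Convergence of the algorithm\<close>

theorem theorem4p2:
  fixes m :: nat
    and idx :: "nat \<Rightarrow> 'm::finite"
    and C :: "nat \<Rightarrow> (real^'n::finite) set"
    and S :: "(real^'n) set"
    and \<rho> \<omega> \<alpha> :: "nat \<Rightarrow> real"
    and u :: "nat \<Rightarrow> ('n, 'm) blocks"
  assumes "m \<ge> 3"
    and "bij_betw idx {1..m} (UNIV :: 'm set)"
    and "\<And>i. i \<in> {1..m} \<Longrightarrow> C i \<noteq> {} \<and> closed (C i) \<and> convex (C i)"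
    and "S \<noteq> {}" and "closed S" and "convex S"
    and "disjoint_family_on C {1..m}"
    and "\<And>i. i \<in> {1..m} \<Longrightarrow> C i \<inter> S = {}"
    and "\<And>i. i \<in> {1..m} \<Longrightarrow> \<rho> i > 0 \<and> \<omega> i > 0"
    and "(\<exists>i\<in>{1..m}. bounded (C i)) \<or> bounded S"
    and "u 0 \<in> feasible m idx C S"
    and "\<And>k. u (Suc k) =
           closest_point (feasible m idx C S) (u k - \<alpha> k *\<^sub>R subgrad m idx \<rho> \<omega> (u k))"
    and "\<And>k. \<alpha> k > 0"
    and "filterlim (\<lambda>N. \<Sum>k<N. \<alpha> k) at_top sequentially"
    and "summable (\<lambda>k. (\<alpha> k)\<^sup>2)"
  shows "(\<exists>ustar. is_arg_min (objective m idx \<rho> \<omega>) (\<lambda>v. v \<in> feasible m idx C S) ustar)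
    \<and> (\<forall>k. subgrad m idx \<rho> \<omega> (u k) \<in> subdifferential (objective m idx \<rho> \<omega>) (u k))
    \<and> (\<forall>ustar. is_arg_min (objective m idx \<rho> \<omega>) (\<lambda>v. v \<in> feasible m idx C S) ustar
         \<longrightarrow> best_value (objective m idx \<rho> \<omega>) u \<longlonglongrightarrow> objective m idx \<rho> \<omega> ustar)
    \<and> (\<exists>ubar. is_arg_min (objective m idx \<rho> \<omega>) (\<lambda>v. v \<in> feasible m idx C S) ubar
         \<and> u \<longlonglongrightarrow> ubar)"
proof -
  let ?X = "feasible m idx C S" and ?J = "objective m idx \<rho> \<omega> :: ('n, 'm) blocks \<Rightarrow> real"
  let ?g = "\<lambda>k. subgrad m idx \<rho> \<omega> (u k)"
  note C = assms(3) and wt = assms(9) and u0 = assms(11) and step = assms(12)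
  have wt': "\<rho> i \<ge> 0 \<and> \<omega> i \<ge> 0" if "i \<in> {1..m}" for i
    using wt[OF that] by simp
  have X: "closed ?X" "convex ?X"
    using C assms(5,6) by (auto intro!: closed_feasible convex_feasible)
  have mem: "u k \<in> ?X" for k
    using u0 X(1) by (cases k) (auto simp: step intro: closest_point_in_set)
  have g: "?g k \<in> subdifferential ?J (u k)" for k
    using subgrad_in_subdifferential[OF _ assms(2) wt', where u = "u k"]
      feasible_blocks_distinct[OF _ assms(7,8) mem] assms(1) by simp
  obtain L where L: "L-lipschitz_on UNIV ?J"
    using lipschitz_objective[where m = m and \<rho> = \<rho> and \<omega> = \<omega>] wt' by metis
  have ex: "\<exists>y. is_arg_min ?J (\<lambda>v. v \<in> ?X) y"
    by (rule exists_arg_min_of_bounded_sublevels[OF X(1) lipschitz_on_continuous_on[OF L] u0])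
      (rule bounded_sublevel_objective[OF assms(2) wt assms(10)])
  note conv = projected_subgradient_convergence[OF X L mem step g assms(13,14,15)]
  show ?thesis
    using ex g conv by blast
qed

end
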